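(* Let $n \geq 5$ be an odd integer, let $m = \lfloor n/2 \rfloor$, and let $$L_n(x_1,\ldots,x_n) := m(n-m)\sum_{1\le i<j\le n}(x_i-x_j)^4 - \Big(\sum_{1\le i<j\le n}(x_i-x_j)^2\Big)^2 .$$ Then $L_n$ is not sos.
   Context: A form is a homogeneous polynomial with real coefficients. A real form $f \in \mathbb{R}[x_1,\ldots,x_n]$ is called a sum of squares (sos) if there exist finitely many real forms $h_1,\ldots,h_k \in \mathbb{R}[x_1,\ldots,x_n]$ with $f = h_1^2+\cdots+h_k^2$. *)

theory Defs
  imports Complex_Main "HOL-Library.Poly_Mapping"
begin

text \<open>
  Real polynomials in the variables \<open>x\<^sub>0, x\<^sub>1, \<dots>\<close> are finitely supported maps from
  monomials (finitely supported exponent maps) to coefficients; the ring operations are those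
  of \<^theory>\<open>HOL-Library.Poly_Mapping\<close>. The ring \<open>\<real>[x\<^sub>1, \<dots>, x\<^sub>n]\<close> is the subset of
  polynomials that only involve the variables with index in \<open>{1..n}\<close>.
\<close>

type_synonym monomial = "nat \<Rightarrow>\<^sub>0 nat"
type_synonym real_mpoly = "monomial \<Rightarrow>\<^sub>0 real"

definition X :: "nat \<Rightarrow> real_mpoly" where
  "X i = Poly_Mapping.single (Poly_Mapping.single i 1) 1"

definition mpolys :: "nat \<Rightarrow> real_mpoly set" where
  "mpolys n = {p. \<forall>u \<in> Poly_Mapping.keys p. Poly_Mapping.keys u \<subseteq> {1..n}}"

definition mon_degree :: "monomial \<Rightarrow> nat" where
  "mon_degree u = (\<Sum>i \<in> Poly_Mapping.keys u. Poly_Mapping.lookup u i)"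

definition homogeneous :: "nat \<Rightarrow> real_mpoly \<Rightarrow> bool" where
  "homogeneous d p \<longleftrightarrow> (\<forall>u \<in> Poly_Mapping.keys p. mon_degree u = d)"

definition forms :: "nat \<Rightarrow> real_mpoly set" where
  "forms n = {p \<in> mpolys n. \<exists>d. homogeneous d p}"

text \<open>
  The number \<open>k\<close> of squares is the length of the list; the degrees of the forms \<open>h\<close> are
  not prescribed.
\<close>

definition sos :: "nat \<Rightarrow> real_mpoly \<Rightarrow> bool" where
  "sos n f \<longleftrightarrow> (\<exists>hs. set hs \<subseteq> forms n \<and> f = (\<Sum>h\<leftarrow>hs. h ^ 2))"

definition L :: "nat \<Rightarrow> real_mpoly" where
  "L n = (let m = nat \<lfloor>real n / 2\<rfloor> in
     of_nat (m * (n - m)) * (\<Sum>i = 1..n. \<Sum>j \<in> {i<..n}. (X i - X j) ^ 4)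
       - (\<Sum>i = 1..n. \<Sum>j \<in> {i<..n}. (X i - X j) ^ 2) ^ 2)"

end

theory Submission imports Defs begin

text \<open>
  Write \<open>n = 2 m + 1\<close>. If \<open>L n\<close> is a sum of squares of forms \<open>h\<close>, then \<open>h\<^sup>2 \<le> L n\<close> pointwise, so
  each \<open>h\<close> vanishes wherever \<open>L n\<close> does. At a 0/1 vector with \<open>k\<close> ones every \<open>(x\<^sub>i - x\<^sub>j)\<^sup>4\<close> equals
  \<open>(x\<^sub>i - x\<^sub>j)\<^sup>2\<close>, which is \<open>1\<close> for exactly \<open>k (n - k)\<close> pairs \<open>i < j\<close> and \<open>0\<close> for the others; hence \<open>L n\<close> has the value
  \<open>e (m (n - m) - e)\<close> there, with \<open>e = k (n - k)\<close> (lemma \<open>peval_L_indicator\<close>). This is zero for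
  both \<open>k = m\<close> and \<open>k = m + 1\<close>, precisely because \<open>n\<close> is odd, and it is positive for \<open>k = 1\<close> once
  \<open>m \<ge> 2\<close>.

  These zeros are too many for a quadratic form: a quadratic form that vanishes on the slices of
  the cube with \<open>m\<close> and with \<open>m + 1\<close> ones is zero (lemma
  \<open>quadratic_form_vanishing_on_slices\<close>). A form \<open>h\<close> of degree other than 2 vanishes everywhere,
  since \<open>t\<^sup>2\<^sup>d h(x)\<^sup>2 \<le> t\<^sup>4 L(x)\<close> for all \<open>t > 0\<close> (lemma \<open>power_comparison_degree\<close>). In both cases
  \<open>h\<close> is zero at the first unit vector, where \<open>L n\<close> is positive: a contradiction.
\<close>

section \<open>Evaluation of polynomials\<close>

text \<open>
  The product runs over the fixed range \<open>{1..n}\<close> and not over the variables that occur in \<open>u\<close>.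
  This makes multiplicativity immediate, at the price that variables outside the range are
  evaluated at \<open>1\<close>.
\<close>

definition mono_at :: "nat \<Rightarrow> (nat \<Rightarrow> real) \<Rightarrow> monomial \<Rightarrow> real" where
  "mono_at n x u = (\<Prod>i = 1..n. x i ^ Poly_Mapping.lookup u i)"

definition peval :: "nat \<Rightarrow> (nat \<Rightarrow> real) \<Rightarrow> real_mpoly \<Rightarrow> real" where
  "peval n x p = (\<Sum>u \<in> Poly_Mapping.keys p. Poly_Mapping.lookup p u * mono_at n x u)"

lemma mono_at_0 [simp]: "mono_at n x 0 = 1"
  by (simp add: mono_at_def)

lemma mono_at_add: "mono_at n x (u + v) = mono_at n x u * mono_at n x v"
  by (simp add: mono_at_def lookup_add power_add prod.distrib)

lemma mono_at_single:
  assumes "i \<in> {1..n}"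
  shows "mono_at n x (Poly_Mapping.single i 1) = x i"
proof -
  have "mono_at n x (Poly_Mapping.single i 1) = (\<Prod>j = 1..n. if i = j then x i else 1)"
    unfolding mono_at_def by (intro prod.cong) (auto simp: lookup_single when_def)
  then show ?thesis
    using assms by simp
qed

lemma peval_superset:
  assumes "finite A" "Poly_Mapping.keys p \<subseteq> A"
  shows "peval n x p = (\<Sum>u\<in>A. Poly_Mapping.lookup p u * mono_at n x u)"
  unfolding peval_def using assms
  by (intro sum.mono_neutral_left) (auto simp: in_keys_iff)

lemma peval_0 [simp]: "peval n x 0 = 0"
  by (simp add: peval_def)

lemma peval_single [simp]: "peval n x (Poly_Mapping.single u c) = c * mono_at n x u"
  by (subst peval_superset[of "{u}"]) auto

lemma peval_1 [simp]: "peval n x 1 = 1"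
  using peval_single[of n x 0 1] by (simp del: peval_single)

lemma peval_add [simp]: "peval n x (p + q) = peval n x p + peval n x q"
proof -
  let ?A = "Poly_Mapping.keys p \<union> Poly_Mapping.keys q"
  have "Poly_Mapping.keys (p + q) \<subseteq> ?A"
    by (rule Poly_Mapping.keys_add)
  then show ?thesis
    by (simp add: peval_superset[of ?A] lookup_add distrib_right sum.distrib)
qed

lemma peval_uminus [simp]: "peval n x (- p) = - peval n x p"
  using peval_add[of n x p "- p"] by simp

lemma peval_diff [simp]: "peval n x (p - q) = peval n x p - peval n x q"
  using peval_add[of n x p "- q"] by simp

lemma peval_sum: "peval n x (\<Sum>i\<in>A. f i) = (\<Sum>i\<in>A. peval n x (f i))"
  by (induction A rule: infinite_finite_induct) auto

lemma peval_sum_list: "peval n x (sum_list ps) = (\<Sum>p\<leftarrow>ps. peval n x p)"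
  by (induction ps) auto

lemma peval_mult [simp]: "peval n x (p * q) = peval n x p * peval n x q"
proof -
  \<comment> \<open>Both sides are biadditive, so it suffices to expand into monomials.\<close>
  have decomp: "r = (\<Sum>u \<in> Poly_Mapping.keys r. Poly_Mapping.single u (Poly_Mapping.lookup r u))"
    for r :: real_mpoly
    by (rule poly_mapping_eqI)
      (auto simp: lookup_sum lookup_single when_def in_keys_iff)
  have "p * q = (\<Sum>u \<in> Poly_Mapping.keys p. \<Sum>v \<in> Poly_Mapping.keys q.
      Poly_Mapping.single (u + v) (Poly_Mapping.lookup p u * Poly_Mapping.lookup q v))"
    by (subst decomp[of p], subst decomp[of q]) (simp add: sum_product mult_single)
  then show ?thesis
    by (simp add: peval_sum peval_def[of n x p] peval_def[of n x q] sum_product mono_at_add mult_ac)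
qed

lemma peval_power [simp]: "peval n x (p ^ k) = peval n x p ^ k"
  by (induction k) auto

lemma peval_of_nat [simp]: "peval n x (of_nat k) = of_nat k"
  by (induction k) auto

lemma peval_X:
  assumes "i \<in> {1..n}"
  shows "peval n x (X i) = x i"
  using mono_at_single[OF assms] by (simp add: X_def)

section \<open>Forms as functions\<close>

lemma mon_degree_eq_sum:
  assumes "Poly_Mapping.keys u \<subseteq> {1..n}"
  shows "mon_degree u = (\<Sum>i = 1..n. Poly_Mapping.lookup u i)"
  unfolding mon_degree_def using assms
  by (intro sum.mono_neutral_left) (auto simp: in_keys_iff)

lemma peval_scale:
  assumes "p \<in> mpolys n" "homogeneous d p"
  shows "peval n (\<lambda>i. t * x i) p = t ^ d * peval n x p"
proof -
  have "mono_at n (\<lambda>i. t * x i) u = t ^ d * mono_at n x u" if "u \<in> Poly_Mapping.keys p" for u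
  proof -
    have "(\<Sum>i = 1..n. Poly_Mapping.lookup u i) = d"
      using assms that mon_degree_eq_sum[of u n] by (auto simp: mpolys_def homogeneous_def)
    then show ?thesis
      by (simp add: mono_at_def power_mult_distrib prod.distrib flip: power_sum)
  qed
  then show ?thesis
    by (simp add: peval_def sum_distrib_left mult_ac)
qed

lemma monomial_split_variable:
  fixes u :: monomial
  assumes "Poly_Mapping.keys u \<subseteq> {1..n}" "(\<Sum>i = 1..n. Poly_Mapping.lookup u i) = Suc d"
  obtains i v where "i \<in> {1..n}" "u = Poly_Mapping.single i 1 + v"
    "Poly_Mapping.keys v \<subseteq> {1..n}" "(\<Sum>i = 1..n. Poly_Mapping.lookup v i) = d"
proof -
  have "\<exists>i\<in>{1..n}. Poly_Mapping.lookup u i \<noteq> 0"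
    using assms(2) sum.neutral[of "{1..n}" "Poly_Mapping.lookup u"] by (metis nat.distinct(1))
  then obtain i where i: "i \<in> {1..n}" "Poly_Mapping.lookup u i \<noteq> 0" by blast
  \<comment> \<open>The truncated subtraction of exponents is exact here, because \<open>i\<close> occurs in \<open>u\<close>.\<close>
  define v where "v = u - Poly_Mapping.single i 1"
  have u: "u = Poly_Mapping.single i 1 + v"
    using i by (intro poly_mapping_eqI) (auto simp: v_def lookup_add lookup_minus lookup_single when_def)
  have "Poly_Mapping.keys v \<subseteq> Poly_Mapping.keys u"
    by (auto simp: u lookup_add in_keys_iff)
  moreover have "(\<Sum>j = 1..n. Poly_Mapping.lookup u j) = 1 + (\<Sum>j = 1..n. Poly_Mapping.lookup v j)"
  proof -
    have "(\<Sum>j = 1..n. Poly_Mapping.lookup (Poly_Mapping.single i (1::nat)) j)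
        = (\<Sum>j = 1..n. if i = j then 1 else 0)"
      by (intro sum.cong refl) (simp add: lookup_single when_def)
    also have "\<dots> = 1" using i(1) by (subst sum.delta') auto
    finally show ?thesis by (simp add: u lookup_add sum.distrib)
  qed
  ultimately show ?thesis
    using that[OF i(1) u] assms by auto
qed

lemma mono_at_degree_2:
  assumes "Poly_Mapping.keys u \<subseteq> {1..n}" "mon_degree u = 2"
  shows "\<exists>i\<in>{1..n}. \<exists>j\<in>{1..n}. \<forall>x. mono_at n x u = x i * x j"
proof -
  have "(\<Sum>i = 1..n. Poly_Mapping.lookup u i) = Suc (Suc 0)"
    using mon_degree_eq_sum[OF assms(1)] assms(2) by simp
  from monomial_split_variable[OF assms(1) this] obtain i v where
    i: "i \<in> {1..n}" "u = Poly_Mapping.single i 1 + v" and v: "Poly_Mapping.keys v \<subseteq> {1..n}"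
    "(\<Sum>i = 1..n. Poly_Mapping.lookup v i) = Suc 0" .
  from monomial_split_variable[OF v] obtain j w where
    j: "j \<in> {1..n}" "v = Poly_Mapping.single j 1 + w"
    and w: "(\<Sum>i = 1..n. Poly_Mapping.lookup w i) = 0" .
  have "mono_at n x w = 1" for x
    using w by (auto simp: mono_at_def intro!: prod.neutral)
  then have "mono_at n x u = x i * x j" for x
    using i j mono_at_single[of _ n x] by (simp add: mono_at_add)
  then show ?thesis using i j by blast
qed

text \<open>
  Grouping the monomials by a choice of their two factors gives some matrix; averaging it with its
  transpose makes it symmetric without changing the form.
\<close>

lemma quadratic_form_matrix:
  assumes "p \<in> mpolys n" "homogeneous 2 p"
  obtains a where "\<And>i j. a i j = a j i"
    "\<And>x. peval n x p = (\<Sum>i = 1..n. \<Sum>j = 1..n. a i j * (x i * x j))"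
proof -
  have "\<forall>u\<in>Poly_Mapping.keys p. \<exists>i\<in>{1..n}. \<exists>j\<in>{1..n}. \<forall>x. mono_at n x u = x i * x j"
    using assms mono_at_degree_2[of _ n] by (auto simp: mpolys_def homogeneous_def)
  then obtain r s where rs: "\<And>u. u \<in> Poly_Mapping.keys p \<Longrightarrow>
      r u \<in> {1..n} \<and> s u \<in> {1..n} \<and> (\<forall>x. mono_at n x u = x (r u) * x (s u))"
    by metis
  define c where "c i j = (\<Sum>u \<in> Poly_Mapping.keys p.
      if r u = i then if s u = j then Poly_Mapping.lookup p u else 0 else 0)" for i j
  have c: "peval n x p = (\<Sum>i = 1..n. \<Sum>j = 1..n. c i j * (x i * x j))" for x
  proof -
    have "(\<Sum>i = 1..n. \<Sum>j = 1..n. c i j * (x i * x j))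
        = (\<Sum>i = 1..n. \<Sum>j = 1..n. \<Sum>u \<in> Poly_Mapping.keys p.
      (if r u = i then if s u = j then Poly_Mapping.lookup p u * (x i * x j) else 0 else 0))"
      unfolding c_def sum_distrib_right by (intro sum.cong refl) simp
    also have "\<dots> = (\<Sum>u \<in> Poly_Mapping.keys p. \<Sum>i = 1..n. \<Sum>j = 1..n.
      (if r u = i then if s u = j then Poly_Mapping.lookup p u * (x i * x j) else 0 else 0))"
      by (subst sum.swap[of _ "Poly_Mapping.keys p"],
          subst sum.swap[of _ "Poly_Mapping.keys p" "{1..n}"]) (rule refl)
    also have "\<dots> = (\<Sum>u \<in> Poly_Mapping.keys p. Poly_Mapping.lookup p u * mono_at n x u)"
    proof (rule sum.cong[OF refl])
      fix u assume "u \<in> Poly_Mapping.keys p"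
      note u = rs[OF this]
      have "(\<Sum>i = 1..n. \<Sum>j = 1..n.
          if r u = i then if s u = j then Poly_Mapping.lookup p u * (x i * x j) else 0 else 0)
        = (\<Sum>i = 1..n. if r u = i
            then \<Sum>j = 1..n. if s u = j then Poly_Mapping.lookup p u * (x i * x j) else 0 else 0)"
        by (intro sum.cong) auto
      then show "(\<Sum>i = 1..n. \<Sum>j = 1..n.
          if r u = i then if s u = j then Poly_Mapping.lookup p u * (x i * x j) else 0 else 0)
        = Poly_Mapping.lookup p u * mono_at n x u"
        using u by simp
    qed
    finally show ?thesis by (simp add: peval_def)
  qed
  have "peval n x p = (\<Sum>i = 1..n. \<Sum>j = 1..n. (c i j + c j i) / 2 * (x i * x j))" for x
  proof -
    have "(\<Sum>i = 1..n. \<Sum>j = 1..n. c j i * (x i * x j)) = peval n x p"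
      by (subst sum.swap) (simp add: c mult_ac)
    then have "2 * peval n x p
        = (\<Sum>i = 1..n. \<Sum>j = 1..n. c i j * (x i * x j)) + (\<Sum>i = 1..n. \<Sum>j = 1..n. c j i * (x i * x j))"
      by (simp add: c)
    also have "\<dots> = 2 * (\<Sum>i = 1..n. \<Sum>j = 1..n. (c i j + c j i) / 2 * (x i * x j))"
      unfolding sum_distrib_left sum.distrib[symmetric]
      by (intro sum.cong refl) (simp add: field_simps)
    finally show ?thesis by simp
  qed
  then show ?thesis
    by (intro that[of "\<lambda>i j. (c i j + c j i) / 2"]) (simp_all add: add.commute)
qed

section \<open>Quadratic forms that vanish on two consecutive slices of the cube\<close>

lemma quadratic_form_indicator:
  fixes a :: "nat \<Rightarrow> nat \<Rightarrow> real"
  assumes "V \<subseteq> {1..n}"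
  shows "(\<Sum>i = 1..n. \<Sum>j = 1..n. a i j * (of_bool (i \<in> V) * of_bool (j \<in> V)))
    = (\<Sum>i\<in>V. \<Sum>j\<in>V. a i j)"
proof -
  have "(\<Sum>j = 1..n. f j * of_bool (j \<in> V)) = (\<Sum>j\<in>V. f j)" for f :: "nat \<Rightarrow> real"
    using assms by (intro sum.mono_neutral_cong_right) auto
  note * = this
  have "(\<Sum>i = 1..n. \<Sum>j = 1..n. a i j * (of_bool (i \<in> V) * of_bool (j \<in> V)))
     = (\<Sum>i = 1..n. (\<Sum>j = 1..n. a i j * of_bool (j \<in> V)) * of_bool (i \<in> V))"
    unfolding sum_distrib_right by (simp only: mult_ac)
  then show ?thesis by (simp only: *)
qed

text \<open>
  Let \<open>q(V)\<close> be the value at the indicator vector of \<open>V\<close>. For \<open>card V = m\<close> and \<open>i \<notin> V\<close>, the difference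
  of the two vanishing values \<open>q(V \<union> {i})\<close> and \<open>q(V)\<close> is \<open>a\<^sub>i\<^sub>i + 2 \<Sum>\<^sub>k a\<^sub>i\<^sub>k\<close>, summed over
  \<open>k \<in> V\<close>. Exchanging one element of \<open>V\<close> shows that row \<open>i\<close> is constant off the diagonal; by
  symmetry all off-diagonal entries equal one number \<open>b\<close>, and then every diagonal entry is
  \<open>- 2 m b\<close>. Now \<open>q(V) = m (- 2 m b) + m (m - 1) b = - m (m + 1) b\<close>, which forces \<open>b = 0\<close>.
  The exchange needs two indices besides \<open>i\<close> and the \<open>m - 1\<close> elements kept in \<open>V\<close>, hence
  \<open>m + 2 \<le> card N\<close>.
\<close>

lemma quadratic_form_vanishing_on_slices:
  fixes a :: "'a \<Rightarrow> 'a \<Rightarrow> real"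
  assumes sym: "\<And>i j. a i j = a j i"
    and N: "finite N" "m + 2 \<le> card N" and m: "m \<ge> 1"
    and zero: "\<And>V. V \<subseteq> N \<Longrightarrow> card V = m \<or> card V = Suc m \<Longrightarrow> (\<Sum>i\<in>V. \<Sum>j\<in>V. a i j) = 0"
    and ij: "i \<in> N" "j \<in> N"
  shows "a i j = 0"
proof -
  have row: "a i i + 2 * (\<Sum>k\<in>V. a i k) = 0"
    if "V \<subseteq> N" "card V = m" "i \<in> N" "i \<notin> V" for V i
  proof -
    have fin: "finite V" using that N finite_subset by blast
    have "(\<Sum>k\<in>insert i V. \<Sum>l\<in>insert i V. a k l)
        = a i i + (\<Sum>k\<in>V. a i k) + (\<Sum>k\<in>V. a k i) + (\<Sum>k\<in>V. \<Sum>l\<in>V. a k l)"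
      using fin that by (simp add: sum.distrib)
    moreover have "(\<Sum>k\<in>V. a k i) = (\<Sum>k\<in>V. a i k)"
      by (intro sum.cong refl sym)
    ultimately show ?thesis
      using zero[of V] zero[of "insert i V"] that fin by simp
  qed
  have swap: "a i k = a i l" if "i \<in> N" "k \<in> N" "l \<in> N" "k \<noteq> i" "l \<noteq> i" for i k l
  proof (cases "k = l")
    case False
    have "card {i, k, l} = 3"
      using False that by auto
    then have "m - 1 \<le> card (N - {i, k, l})"
      using diff_card_le_card_Diff[of "{i, k, l}" N] N by simp
    then obtain U where U: "U \<subseteq> N - {i, k, l}" "card U = m - 1"
      by (meson obtain_subset_with_card_n)
    have fin: "finite U" using U N finite_subset by blast
    have notin: "i \<notin> U" "k \<notin> U" "l \<notin> U" using U by auto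
    have "a i i + 2 * (\<Sum>h\<in>insert h U. a i h) = 0" if "h \<in> {k, l}" for h
      using U fin notin that \<open>i \<in> N\<close> \<open>k \<in> N\<close> \<open>l \<in> N\<close> \<open>k \<noteq> i\<close> \<open>l \<noteq> i\<close> m
      by (intro row) auto
    from this[of k] this[of l] show ?thesis using fin notin by simp
  qed simp
  obtain W where W: "W \<subseteq> N" "card W = 2"
    using obtain_subset_with_card_n[of 2 N] N by auto
  then obtain p q where pq: "p \<in> N" "q \<in> N" "p \<noteq> q"
    by (auto simp: card_2_iff)
  define b where "b = a p q"
  have off: "a i j = b" if "i \<in> N" "j \<in> N" "i \<noteq> j" for i j
  proof (cases "i = p")
    case True
    then show ?thesis using swap[of p j q] that pq by (auto simp: b_def)
  next
    case False
    then show ?thesis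
      using swap[of i j p] swap[of p i q] sym[of i p] that pq by (auto simp: b_def)
  qed
  have diag: "a i i = - 2 * real m * b" if "i \<in> N" for i
  proof -
    have "m \<le> card (N - {i})"
      using N \<open>i \<in> N\<close> by simp
    then obtain V where V: "V \<subseteq> N - {i}" "card V = m"
      by (meson obtain_subset_with_card_n)
    have "(\<Sum>k\<in>V. a i k) = (\<Sum>k\<in>V. b)"
      using V \<open>i \<in> N\<close> by (intro sum.cong off) auto
    moreover have "a i i + 2 * (\<Sum>k\<in>V. a i k) = 0"
      using V \<open>i \<in> N\<close> by (intro row) auto
    ultimately show ?thesis using V by simp
  qed
  obtain V where V: "V \<subseteq> N" "card V = m"
    using obtain_subset_with_card_n[of m N] N by auto
  have finV: "finite V" using V N finite_subset by blast
  have "(\<Sum>k\<in>V. \<Sum>l\<in>V. a k l) = (\<Sum>k\<in>V. - 2 * real m * b + (real m - 1) * b)"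
  proof (rule sum.cong[OF refl])
    fix k assume k: "k \<in> V"
    have "(\<Sum>l\<in>V. a k l) = a k k + (\<Sum>l\<in>V - {k}. a k l)"
      using k finV by (rule sum.remove[rotated])
    also have "(\<Sum>l\<in>V - {k}. a k l) = (\<Sum>l\<in>V - {k}. b)"
      using V k by (intro sum.cong off) auto
    finally show "(\<Sum>l\<in>V. a k l) = - 2 * real m * b + (real m - 1) * b"
      using diag[of k] k V finV m by (auto simp: of_nat_diff)
  qed
  then have "m * (- 2 * real m * b + (real m - 1) * b) = 0"
    using zero[of V] V by simp
  then have "real m * (real m + 1) * b = 0" by algebra
  then have "b = 0" using m by auto
  then show ?thesis using off[of i j] diag[of i] ij by (cases "i = j") auto
qed

section \<open>Values of the form on the cube\<close>

lemma Lagrange_identity_ones: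
  fixes x :: "nat \<Rightarrow> real"
  shows "(\<Sum>i = 1..n. \<Sum>j \<in> {i<..n}. (x i - x j) ^ 2)
    = n * (\<Sum>i = 1..n. x i ^ 2) - (\<Sum>i = 1..n. x i) ^ 2"
proof (induction n)
  case (Suc n)
  have *: "{i<..Suc n} = insert (Suc n) {i<..n}" if "i \<in> {1..n}" for i
    using that by auto
  have "(\<Sum>i = 1..Suc n. \<Sum>j \<in> {i<..Suc n}. (x i - x j) ^ 2)
      = (\<Sum>i = 1..n. \<Sum>j \<in> {i<..n}. (x i - x j) ^ 2) + (\<Sum>i = 1..n. (x i - x (Suc n)) ^ 2)"
    by (simp add: * sum.distrib)
  also have "(\<Sum>i = 1..n. (x i - x (Suc n)) ^ 2)
      = (\<Sum>i = 1..n. x i ^ 2) + n * x (Suc n) ^ 2 - 2 * x (Suc n) * (\<Sum>i = 1..n. x i)"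
    by (simp add: power2_diff sum.distrib sum_subtractf sum_distrib_left mult_ac)
  finally show ?case
    unfolding Suc.IH by (simp add: algebra_simps power2_eq_square)
qed simp

lemma peval_L:
  "peval n x (L n) = real (n div 2 * (n - n div 2)) * (\<Sum>i = 1..n. \<Sum>j \<in> {i<..n}. (x i - x j) ^ 4)
    - (\<Sum>i = 1..n. \<Sum>j \<in> {i<..n}. (x i - x j) ^ 2) ^ 2"
proof -
  have *: "nat \<lfloor>real n / 2\<rfloor> = n div 2"
    using floor_divide_of_nat_eq[of n 2, where ?'a = real] by simp
  show ?thesis
    by (simp add: L_def Let_def * peval_sum peval_X del: of_nat_mult)
qed

text \<open>
  On the cube each difference is \<open>0\<close> or \<open>\<plusminus>1\<close>, so the sums of fourth powers and of squares agree;
  the latter is \<open>n k - k\<^sup>2\<close> for \<open>k = card S\<close> by Lagrange's identity.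
\<close>

lemma peval_L_indicator:
  assumes "S \<subseteq> {1..n}"
  defines "e \<equiv> real (card S) * (real n - real (card S))"
  shows "peval n (\<lambda>i. of_bool (i \<in> S)) (L n) = e * (real (n div 2 * (n - n div 2)) - e)"
proof -
  let ?x = "\<lambda>i. of_bool (i \<in> S) :: real"
  have sum: "(\<Sum>i = 1..n. ?x i) = card S"
    using assms(1) by (simp add: Int_absorb1)
  have "(\<Sum>i = 1..n. \<Sum>j \<in> {i<..n}. (?x i - ?x j) ^ 2) = e"
  proof -
    have "(\<Sum>i = 1..n. (?x i) ^ 2) = (\<Sum>i = 1..n. ?x i)" by (intro sum.cong) auto
    then show ?thesis
      unfolding Lagrange_identity_ones sum e_def
      by (simp only: sum) (simp add: algebra_simps power2_eq_square)
  qed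
  moreover have "(\<Sum>i = 1..n. \<Sum>j \<in> {i<..n}. (?x i - ?x j) ^ 4)
      = (\<Sum>i = 1..n. \<Sum>j \<in> {i<..n}. (?x i - ?x j) ^ 2)"
    by (intro sum.cong refl) auto
  ultimately show ?thesis
    by (simp add: peval_L algebra_simps power2_eq_square)
qed

section \<open>No sum of squares\<close>

text \<open>
  If \<open>d < e\<close> the inequality fails for small \<open>t\<close>, and if \<open>d > e\<close> for large \<open>t\<close>. As the degrees of
  the summands are not prescribed, this is what forces every summand that is not zero as a
  function to be the square of a form of half the degree of the sum.
\<close>

lemma power_comparison_degree:
  fixes a b :: real
  assumes "a > 0" and le: "\<And>t. t > 0 \<Longrightarrow> t ^ d * a \<le> t ^ e * b"
  shows "d = e"
proof (rule ccontr)
  assume "d \<noteq> e"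
  have b: "b \<ge> a" using le[of 1] by simp
  consider "d < e" | "e < d" using \<open>d \<noteq> e\<close> by linarith
  then show False
  proof cases
    case 1
    \<comment> \<open>Since \<open>t \<le> 1\<close>, the factor \<open>t\<^sup>e\<^sup>-\<^sup>d\<close> is at most \<open>t\<close>, and \<open>t b = a / 2\<close>.\<close>
    define t where "t = a / (2 * b)"
    have t: "0 < t" "t \<le> 1" using b assms(1) by (auto simp: t_def field_simps)
    have "t ^ e = t ^ d * t ^ (e - d)" using 1 by (simp flip: power_add)
    then have "a \<le> t ^ (e - d) * b" using le[OF t(1)] t by (simp add: mult_ac)
    also have "\<dots> \<le> t * b"
      using power_decreasing[of 1 "e - d" t] t 1 b assms(1) by (intro mult_right_mono) auto
    also have "\<dots> < a" using b assms(1) by (simp add: t_def)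
    finally show False by simp
  next
    case 2
    \<comment> \<open>Since \<open>t \<ge> 1\<close>, the factor \<open>t\<^sup>d\<^sup>-\<^sup>e\<close> is at least \<open>t\<close>, and \<open>t a = 2 b\<close>.\<close>
    define t where "t = 2 * b / a"
    have t: "t \<ge> 1" using b assms(1) by (auto simp: t_def field_simps)
    have "t ^ d = t ^ e * t ^ (d - e)" using 2 by (simp flip: power_add)
    then have "t ^ (d - e) * a \<le> b" using le[of t] t by (simp add: mult_ac)
    moreover have "t * a \<le> t ^ (d - e) * a"
      using power_increasing[of 1 "d - e" t] t 2 assms(1) by (intro mult_right_mono) auto
    moreover have "b < t * a" using b assms(1) by (simp add: t_def)
    ultimately show False by simp
  qed
qed

theorem theorem2p8:
  fixes n :: nat
  assumes "n \<ge> 5" and "odd n"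
  shows "\<not> sos n (L n)"
proof
  assume "sos n (L n)"
  then obtain hs where hs: "set hs \<subseteq> forms n" and L: "L n = (\<Sum>h\<leftarrow>hs. h ^ 2)"
    by (auto simp: sos_def)
  define m where "m = n div 2"
  have n: "n = 2 * m + 1" and m: "m \<ge> 2"
    using assms by (auto simp: m_def)
  have sum: "peval n x (L n) = (\<Sum>h\<leftarrow>hs. (peval n x h) ^ 2)" for x
    by (simp add: L peval_sum_list comp_def)
  have le: "(peval n x h) ^ 2 \<le> peval n x (L n)" if "h \<in> set hs" for x h
    unfolding sum using that by (intro member_le_sum_list) auto
  have scale: "peval n (\<lambda>i. t * x i) (L n) = t ^ 4 * peval n x (L n)" for t x
    unfolding peval_L
    by (simp add: right_diff_distrib[symmetric] power_mult_distrib sum_distrib_left[symmetric])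
      (simp add: algebra_simps)
  let ?e = "\<lambda>i. of_bool (i \<in> {1}) :: real"
  have h0: "peval n ?e h = 0" if h: "h \<in> set hs" for h
  proof (rule ccontr)
    assume nz: "peval n ?e h \<noteq> 0"
    obtain d where d: "h \<in> mpolys n" "homogeneous d h"
      using h hs by (auto simp: forms_def)
    have "2 * d = 4"
    proof (rule power_comparison_degree)
      show "0 < (peval n ?e h) ^ 2" using nz by simp
      show "t ^ (2 * d) * (peval n ?e h) ^ 2 \<le> t ^ 4 * peval n ?e (L n)" for t
        using le[OF h, of "\<lambda>i. t * ?e i"]
        by (simp add: scale peval_scale[OF d] power_mult_distrib mult.commute[of 2] flip: power_mult)
    qed
    then have d2: "homogeneous 2 h" using d by simp
    obtain a where sym: "\<And>i j. a i j = a j i"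
      and a: "\<And>x. peval n x h = (\<Sum>i = 1..n. \<Sum>j = 1..n. a i j * (x i * x j))"
      by (rule quadratic_form_matrix[OF d(1) d2]) blast
    have on_cube: "peval n (\<lambda>i. of_bool (i \<in> V)) h = (\<Sum>i\<in>V. \<Sum>j\<in>V. a i j)"
      if "V \<subseteq> {1..n}" for V
      unfolding a by (rule quadratic_form_indicator[OF that])
    \<comment> \<open>The entry at \<open>(1, 1)\<close> is the value of \<open>h\<close> at the first unit vector.\<close>
    have "a 1 1 = 0"
    proof (rule quadratic_form_vanishing_on_slices[where a = a and N = "{1..n}" and m = m])
      show "a i j = a j i" for i j by (rule sym)
    next
      fix V assume V: "V \<subseteq> {1..n}" "card V = m \<or> card V = Suc m"
      have "peval n (\<lambda>i. of_bool (i \<in> V)) (L n) = 0"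
        unfolding peval_L_indicator[OF V(1)] using V(2)
        by (elim disjE) (simp_all add: n algebra_simps)
      then have "peval n (\<lambda>i. of_bool (i \<in> V)) h = 0"
        using le[OF h, of "\<lambda>i. of_bool (i \<in> V)"] by simp
      then show "(\<Sum>i\<in>V. \<Sum>j\<in>V. a i j) = 0" using on_cube[OF V(1)] by simp
    qed (use n m in auto)
    then show False using nz on_cube[of "{1}"] n by simp
  qed
  have "(\<Sum>h\<leftarrow>hs. (peval n ?e h) ^ 2) = (\<Sum>h\<leftarrow>hs. 0)"
    using h0 by (intro arg_cong[where f = sum_list] map_cong) auto
  then have "peval n ?e (L n) = 0" unfolding sum by simp
  moreover have "peval n ?e (L n) = 2 * m * (m * (real m + 1) - 2 * m)"
    using peval_L_indicator[of "{1}" n] by (simp add: n algebra_simps)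
  ultimately have "real m * (real m + 1) = 2 * real m" using m by simp
  then show False using m by (simp add: algebra_simps)
qed

end
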